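(* Fix $\eta\in(0,1/2)$. For every integer $N\ge1$, every odd prime $p$ and every $\alpha\in\mathscr B(p,N)$, letting $A=A_{p,N}(\alpha,\mathcal V)=\frac1{\#\mathcal V(p,N)}\sum_{x\in\mathcal V(p,N)}\mathfrak d_{p,N}(\alpha,x)^2$ and $\mathcal I=[\sqrt A-p^{-\eta},\sqrt A+p^{-\eta}]$, we have \[ \frac1{\#\mathcal V(p,N)^2}\#\big\{(\beta_1,\beta_2)\in\mathcal V(p,N)^2:\ \mathfrak d_{p,N}(\alpha,\beta_1)\in\mathcal I\text{ and }\mathfrak d_{p,N}(\alpha,\beta_2)\in\mathcal I\big\}\ \ge\ 1-\frac{44}{p^{1-2\eta}}. \]
   Context: $\omega=\exp(2\pi i/p)$; $\mathscr B(p,N)=\{\sum_{j=1}^{p-1}a_j\omega^j: a_j\in[-N,N]\cap\mathbb{Z}\}$, $\mathcal V(p,N)=\{\sum_{j=1}^{p-1}a_j\omega^j: a_j\in\{-N,N\}\}$. For $\gamma\in\mathbb{Q}(\omega)$, $\mathrm{Tr}(\gamma)=\sum_{\sigma\in\mathrm{Gal}(\mathbb{Q}(\omega)/\mathbb{Q})}\sigma(\gamma)$, $\|\gamma\|=\big(\sum_{j=1}^{p-1}\mathrm{Tr}(\gamma\omega^j)^2\big)^{1/2}$, $\mathfrak d_{p,N}(\alpha,\beta)=\|\beta-\alpha\|/(2Np(p-1)^{1/2})$. *)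

theory Defs
  imports "HOL-Analysis.Analysis" "HOL-Algebra.Generated_Fields"
    "HOL-Algebra.Algebraic_Closure_Type"
begin

definition zeta :: "nat \<Rightarrow> complex" where
  "zeta p = exp (2 * of_real pi * \<i> / of_nat p)"

definition cyclotomic_field :: "nat \<Rightarrow> complex set" where
  "cyclotomic_field p = generate_field (ring_of_type_algebra :: complex ring) (\<rat> \<union> {zeta p})"

definition cyclotomic_ring :: "nat \<Rightarrow> complex ring" where
  "cyclotomic_ring p = ring_of_type_algebra \<lparr>carrier := cyclotomic_field p\<rparr>"

text \<open>Automorphisms are total functions on \<^typ>\<open>complex\<close>; extensionality makes each field
  automorphism be represented by exactly one function, so that sums over the group count it once.\<close>

definition galois_group :: "nat \<Rightarrow> (complex \<Rightarrow> complex) set" where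
  "galois_group p =
     {\<sigma> \<in> ring_iso (cyclotomic_ring p) (cyclotomic_ring p).
        \<sigma> \<in> extensional (cyclotomic_field p) \<and> (\<forall>q\<in>\<rat>. \<sigma> q = q)}"

definition cyc_trace :: "nat \<Rightarrow> complex \<Rightarrow> complex" where
  "cyc_trace p \<gamma> = (\<Sum>\<sigma>\<in>galois_group p. \<sigma> \<gamma>)"

text \<open>For elements of the cyclotomic field the traces are rational, so the sum below is a
  nonnegative rational and \<^const>\<open>Re\<close> only changes its type from complex to real.\<close>

definition cyc_norm :: "nat \<Rightarrow> complex \<Rightarrow> real" where
  "cyc_norm p \<gamma> = sqrt (Re (\<Sum>j=1..p-1. (cyc_trace p (\<gamma> * zeta p ^ j))\<^sup>2))"

definition cyc_dist :: "nat \<Rightarrow> nat \<Rightarrow> complex \<Rightarrow> complex \<Rightarrow> real" where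
  "cyc_dist p N \<alpha> \<beta> =
     cyc_norm p (\<beta> - \<alpha>) / (2 * real N * real p * sqrt (real p - 1))"

definition cyc_box :: "nat \<Rightarrow> nat \<Rightarrow> complex set" where
  "cyc_box p N =
     {\<Sum>j=1..p-1. of_int (a j) * zeta p ^ j | a :: nat \<Rightarrow> int.
        \<forall>j\<in>{1..p-1}. a j \<in> {- int N..int N}}"

definition cyc_vertices :: "nat \<Rightarrow> nat \<Rightarrow> complex set" where
  "cyc_vertices p N =
     {\<Sum>j=1..p-1. of_int (a j) * zeta p ^ j | a :: nat \<Rightarrow> int.
        \<forall>j\<in>{1..p-1}. a j \<in> {- int N, int N}}"

definition mean_sq_dist :: "nat \<Rightarrow> nat \<Rightarrow> complex \<Rightarrow> complex set \<Rightarrow> real" where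
  "mean_sq_dist p N \<alpha> S = (1 / real (card S)) * (\<Sum>x\<in>S. (cyc_dist p N \<alpha> x)\<^sup>2)"

end

theory Submission
  imports Defs
begin

text \<open>
  The Galois group of \<open>\<rat>(\<omega>)\<close> is in bijection with the primitive \<open>p\<close>-th roots of unity, so the trace of
  \<open>\<omega>\<^sup>m\<close> is \<open>p - 1\<close> if \<open>p\<close> divides \<open>m\<close> and \<open>- 1\<close> otherwise. Hence an element with coordinates
  \<open>c\<^sub>j\<close> has squared norm \<open>p\<^sup>2 (\<Sum>j. c\<^sub>j\<^sup>2) - (p + 1) (\<Sum>j. c\<^sub>j)\<^sup>2\<close>, and the squared distance from
  \<open>\<alpha>\<close> to a uniformly random vertex is a quadratic form in \<open>p - 1\<close> independent signs. Its mean \<open>A\<close> is bounded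
  below and its variance is \<open>O(1/p)\<close>. As \<open>A (D - \<surd>A)\<^sup>2 \<le> (D\<^sup>2 - A)\<^sup>2\<close>, Chebyshev's inequality
  shows that the distance \<open>D\<close> itself is concentrated around \<open>\<surd>A\<close>.
\<close>

section \<open>Cyclotomic polynomials of prime order\<close>

text \<open>Coefficients stay integral while the point varies over an arbitrary commutative ring.
  One polynomial can thus be compared at all roots of unity, and Gauss's lemma over the integers
  remains available.\<close>

definition int_eval :: "int poly \<Rightarrow> 'a::comm_ring_1 \<Rightarrow> 'a" where
  "int_eval f z = poly (map_poly of_int f) z"

lemma int_eval_0 [simp]: "int_eval 0 z = 0"
  by (simp add: int_eval_def)

lemma int_eval_pCons [simp]: "int_eval (pCons a f) z = of_int a + z * int_eval f z"
  by (simp add: int_eval_def map_poly_pCons)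

lemma int_eval_1 [simp]: "int_eval 1 z = 1"
  by (simp add: one_pCons)

lemma int_eval_monom [simp]: "int_eval (Polynomial.monom a n) z = of_int a * z ^ n"
  by (simp add: int_eval_def map_poly_monom Polynomial.poly_monom)

lemma int_eval_add [simp]: "int_eval (f + g) z = int_eval f z + int_eval g z"
proof -
  have "map_poly of_int (f + g) = (map_poly of_int f + map_poly of_int g :: 'a poly)"
    by (rule poly_eqI) (simp add: coeff_map_poly)
  thus ?thesis by (simp add: int_eval_def)
qed

lemma int_eval_minus [simp]: "int_eval (- f) z = - int_eval f z"
  by (metis add_eq_0_iff int_eval_0 int_eval_add right_minus)

lemma int_eval_diff [simp]: "int_eval (f - g) z = int_eval f z - int_eval g z"
  by (metis diff_conv_add_uminus int_eval_add int_eval_minus)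

lemma int_eval_smult [simp]: "int_eval (Polynomial.smult a f) z = of_int a * int_eval f z"
  by (induction f) (auto simp: algebra_simps)

lemma int_eval_mult [simp]: "int_eval (f * g) z = int_eval f z * int_eval g z"
  by (induction f) (auto simp: algebra_simps)

lemma int_eval_sum [simp]: "int_eval (sum f A) z = (\<Sum>i\<in>A. int_eval (f i) z)"
  by (induction A rule: infinite_finite_induct) auto

lemma int_eval_pcompose: "int_eval (pcompose f g) z = int_eval f (int_eval g z)"
  by (induction f) (auto simp: pcompose_pCons)

section \<open>Eisenstein's criterion\<close>

lemma prime_elem_dvd_coeff_factor:
  fixes f g :: "'a :: comm_ring_1 poly"
  assumes q: "prime_elem q" and g0: "\<not> q dvd Polynomial.coeff g 0"
    and fg: "\<And>i. i < n \<Longrightarrow> q dvd Polynomial.coeff (f * g) i" and "i < n"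
  shows "q dvd Polynomial.coeff f i"
  using \<open>i < n\<close>
proof (induction i rule: less_induct)
  case (less i)
  have "Polynomial.coeff (f * g) i = (\<Sum>j\<in>insert i {..<i}. Polynomial.coeff f j * Polynomial.coeff g (i - j))"
    unfolding coeff_mult by (rule sum.cong) auto
  also have "\<dots> = Polynomial.coeff f i * Polynomial.coeff g 0 + (\<Sum>j<i. Polynomial.coeff f j * Polynomial.coeff g (i - j))"
    by (subst sum.insert) auto
  finally have eq: "Polynomial.coeff f i * Polynomial.coeff g 0 = Polynomial.coeff (f * g) i - (\<Sum>j<i. Polynomial.coeff f j * Polynomial.coeff g (i - j))"
    by simp
  \<comment> \<open>By induction \<open>q\<close> divides the coefficients of \<open>f\<close> of
    index below \<open>i\<close>. So modulo \<open>q\<close> only the product of coefficient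
    \<open>i\<close> of \<open>f\<close> with the constant coefficient of \<open>g\<close> is
    left.\<close>
  have "q dvd (\<Sum>j<i. Polynomial.coeff f j * Polynomial.coeff g (i - j))"
    using less by (intro dvd_sum dvd_mult2) auto
  hence "q dvd Polynomial.coeff f i * Polynomial.coeff g 0"
    unfolding eq using fg[OF less.prems] by (rule dvd_diff[rotated])
  thus ?case
    using q g0 by (simp add: prime_elem_dvd_mult_iff)
qed

text \<open>As \<open>q\<^sup>2\<close> does not divide the constant coefficient of the product, one
  factor \<open>v\<close> has a constant coefficient not divisible by \<open>q\<close>. If
  \<open>v\<close> were not constant, the cofactor would have degree below that of the product, so
  by the preceding lemma \<open>q\<close> would divide its leading coefficient and hence that of the
  product.\<close>

lemma eisenstein_criterion:
  fixes f g :: "'a :: idom poly"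
  assumes q: "prime_elem q" and dvd: "\<And>i. i < Polynomial.degree (f * g) \<Longrightarrow> q dvd Polynomial.coeff (f * g) i"
    and lead: "\<not> q dvd Polynomial.lead_coeff (f * g)" and const: "\<not> q\<^sup>2 dvd Polynomial.coeff (f * g) 0"
  shows "Polynomial.degree f = 0 \<or> Polynomial.degree g = 0"
proof -
  have *: "Polynomial.degree v = 0" if fg: "u * v = f * g" and v: "\<not> q dvd Polynomial.coeff v 0" for u v
  proof (rule ccontr)
    assume dv: "Polynomial.degree v \<noteq> 0"
    from lead have "u * v \<noteq> 0" using fg by auto
    hence "Polynomial.degree (f * g) = Polynomial.degree u + Polynomial.degree v"
      using fg by (metis degree_mult_eq mult_eq_0_iff)
    hence "Polynomial.degree u < Polynomial.degree (f * g)" using dv by simp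
    hence "q dvd Polynomial.lead_coeff u"
      using prime_elem_dvd_coeff_factor[OF q v, of "Polynomial.degree (f * g)" u "Polynomial.degree u"] dvd fg by simp
    hence "q dvd Polynomial.lead_coeff (u * v)"
      by (simp add: lead_coeff_mult)
    thus False using lead fg by simp
  qed
  have "\<not> q dvd Polynomial.coeff f 0 \<or> \<not> q dvd Polynomial.coeff g 0"
    using const by (auto simp: coeff_mult power2_eq_square intro: mult_dvd_mono)
  thus ?thesis
    using *[of f g] *[of g f] by (auto simp: mult.commute)
qed

section \<open>The cyclotomic polynomial of prime order and its irreducibility\<close>

definition cyclotomic_prime :: "nat \<Rightarrow> int poly" where
  "cyclotomic_prime p = (\<Sum>i<p. Polynomial.monom 1 i)"

lemma coeff_cyclotomic_prime: "Polynomial.coeff (cyclotomic_prime p) i = (if i < p then 1 else 0)"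
  by (simp add: cyclotomic_prime_def coeff_sum)

lemma degree_cyclotomic_prime: "p > 0 \<Longrightarrow> Polynomial.degree (cyclotomic_prime p) = p - 1"
  by (intro antisym degree_le le_degree) (auto simp: coeff_cyclotomic_prime)

lemma cyclotomic_prime_mult: "[:- 1, 1:] * cyclotomic_prime p = Polynomial.monom 1 p - 1"
proof (rule poly_eqI)
  fix i show "Polynomial.coeff ([:- 1, 1:] * cyclotomic_prime p) i = Polynomial.coeff (Polynomial.monom 1 p - 1) i"
    by (cases i) (auto simp: coeff_cyclotomic_prime)
qed

lemma int_eval_cyclotomic_prime:
  fixes z :: "'a :: idom"
  assumes "z ^ p = 1" "z \<noteq> 1"
  shows "int_eval (cyclotomic_prime p) z = 0"
proof -
  have "(z - 1) * int_eval (cyclotomic_prime p) z = int_eval (Polynomial.monom 1 p - 1) z"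
    unfolding cyclotomic_prime_mult[symmetric] int_eval_mult by simp
  with assms show ?thesis by simp
qed

lemma pcompose_power: "pcompose (f ^ n) g = pcompose f g ^ n"
  by (induction n) (simp_all add: pcompose_1 pcompose_mult)

text \<open>Substituting X + 1 into (X - 1) * \<open>cyclotomic_prime p\<close> = X^p - 1 shows that
  X times the shifted polynomial is (1 + X)^p - 1. The operation \<open>pCons 0\<close> is this
  multiplication by X and accounts for the index \<open>Suc i\<close>.\<close>

lemma coeff_cyclotomic_prime_shift:
  "Polynomial.coeff (pcompose (cyclotomic_prime p) [:1, 1:]) i = int (p choose Suc i)"
proof -
  let ?P = "pcompose (cyclotomic_prime p) [:1, 1:]"
  have "pCons 0 ?P = pcompose ([:- 1, 1:] * cyclotomic_prime p) [:1, 1:]"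
    unfolding pcompose_mult by (simp add: pcompose_pCons)
  also have "\<dots> = pcompose (Polynomial.monom 1 1 ^ p - 1) [:1, 1:]"
    by (simp only: cyclotomic_prime_mult monom_power) simp
  also have "\<dots> = [:1, 1:] ^ p - 1"
    by (simp add: pcompose_diff pcompose_power pcompose_1 Polynomial.monom_altdef pcompose_pCons)
  finally have "Polynomial.coeff (pCons 0 ?P) (Suc i) = Polynomial.coeff ([:1, 1:] ^ p - 1) (Suc i)" by simp
  also have "\<dots> = Polynomial.coeff ([:1, 1:] ^ p) (Suc i)" by simp
  also have "\<dots> = int (p choose Suc i)"
    by (cases "Suc i \<le> p") (simp_all add: coeff_linear_poly_power coeff_eq_0 degree_linear_power)
  finally show ?thesis by simp
qed

text \<open>The shift by 1 preserves products and degrees, and it turns the coefficients into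
  binomial coefficients, to which Eisenstein's criterion at \<open>p\<close> applies.\<close>

lemma cyclotomic_prime_factor:
  assumes p: "Factorial_Ring.prime p" and fg: "f * g = cyclotomic_prime p"
  shows "Polynomial.degree f = 0 \<or> Polynomial.degree g = 0"
proof -
  let ?s = "\<lambda>h :: int poly. pcompose h [:1, 1:]"
  have eq: "?s f * ?s g = ?s (cyclotomic_prime p)"
    by (simp add: pcompose_mult flip: fg)
  have p0: "p > 0" "p > 1" using p prime_gt_0_nat prime_gt_1_nat by auto
  have deg: "Polynomial.degree (?s (cyclotomic_prime p)) = p - 1"
    using p0 by (simp add: degree_pcompose degree_cyclotomic_prime)
  have "Polynomial.degree (?s f) = 0 \<or> Polynomial.degree (?s g) = 0"
  proof (rule eisenstein_criterion[of "int p"], unfold eq deg coeff_cyclotomic_prime_shift)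
    show "prime_elem (int p)" using p by simp
    show "int p dvd int (p choose Suc i)" if "i < p - 1" for i
      using that p by (auto intro!: dvd_choose_prime)
    show "\<not> int p dvd int (p choose Suc (p - 1))"
      using p0 by simp
    show "\<not> (int p)\<^sup>2 dvd int (p choose Suc 0)"
      using p0 by (auto simp: power2_eq_square dest!: zdvd_imp_le)
  qed
  thus ?thesis by (simp add: degree_pcompose)
qed

text \<open>Let \<open>g0\<close> be the primitive part of a nonzero integer polynomial of least
  degree that vanishes at \<open>z\<close>. Then \<open>g0\<close> divides every integer polynomial
  vanishing at \<open>z\<close>, in particular the cyclotomic one. Irreducibility makes the cofactor
  constant, and the leading coefficient 1 makes it a unit, so the two polynomials are
  associated.\<close>

lemma cyclotomic_prime_dvd:
  fixes z :: "'a :: {idom, ring_char_0}"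
  assumes p: "Factorial_Ring.prime p" and z: "z ^ p = 1" "z \<noteq> 1" and f: "int_eval f z = 0"
  shows "cyclotomic_prime p dvd f"
proof -
  define P where "P g \<longleftrightarrow> g \<noteq> 0 \<and> int_eval g z = 0" for g
  have p0: "p > 0" using p prime_gt_0_nat by auto
  have "Polynomial.coeff (cyclotomic_prime p) 0 \<noteq> 0" using p0 by (simp add: coeff_cyclotomic_prime)
  hence "P (cyclotomic_prime p)"
    using z by (auto simp: P_def int_eval_cyclotomic_prime)
  then obtain g where g: "P g" and min: "\<And>h. P h \<Longrightarrow> Polynomial.degree g \<le> Polynomial.degree h"
    using ex_has_least_nat[of P _ Polynomial.degree] by blast
  define g0 where "g0 = primitive_part g"
  have cont: "content g0 = 1" using g by (simp add: g0_def P_def)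
  have deg: "Polynomial.degree g0 = Polynomial.degree g" by (simp add: g0_def)
  have "of_int (content g) * int_eval g0 z = int_eval g z"
    unfolding g0_def int_eval_smult[symmetric] by simp
  hence g0: "int_eval g0 z = 0" "g0 \<noteq> 0" using g by (auto simp: P_def g0_def)
  have dvd: "g0 dvd h" if h: "int_eval h z = 0" for h
  proof -
    \<comment> \<open>Over the integers division with remainder works only after scaling by some
      nonzero \<open>a\<close>. The remainder vanishes at \<open>z\<close>, so minimality makes it
      zero; as \<open>g0\<close> is primitive, \<open>a\<close> divides the content of
      \<open>q\<close> and can be cancelled.\<close>
    obtain a q where a: "a \<noteq> 0" "Polynomial.smult a h = g0 * q + pseudo_mod h g0"
      using pseudo_mod(1)[OF g0(2)] by blast
    have "int_eval (Polynomial.smult a h) z = 0" using h by simp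
    hence "int_eval (pseudo_mod h g0) z = 0" unfolding a using g0 by simp
    hence "\<not> Polynomial.degree (pseudo_mod h g0) < Polynomial.degree g0" if "pseudo_mod h g0 \<noteq> 0"
      using min[of "pseudo_mod h g0"] deg that by (simp add: P_def)
    hence "pseudo_mod h g0 = 0"
      using pseudo_mod(2)[OF g0(2), of h] by blast
    with a have eq: "Polynomial.smult a h = g0 * q" by simp
    have "content q = content (Polynomial.smult a h)" unfolding eq by (simp add: content_mult cont)
    hence "a dvd content q" by simp
    hence "[:a:] dvd q" by (simp add: const_poly_dvd_iff_dvd_content)
    then obtain q' where "q = Polynomial.smult a q'" by auto
    with eq a have "h = g0 * q'" by (metis mult_smult_right smult_cancel)
    thus ?thesis by simp
  qed
  obtain q where q: "cyclotomic_prime p = g0 * q"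
    using dvd[OF int_eval_cyclotomic_prime[OF z]] by blast
  have "Polynomial.degree g0 \<noteq> 0"
  proof
    assume "Polynomial.degree g0 = 0"
    then obtain c where "g0 = [:c:]" by (metis degree_0_id)
    with g0 show False by simp
  qed
  with cyclotomic_prime_factor[OF p q[symmetric]] obtain c where c: "q = [:c:]"
    by (metis degree_0_id)
  have "Polynomial.lead_coeff (cyclotomic_prime p) = Polynomial.lead_coeff g0 * c"
    unfolding q c by simp
  hence "Polynomial.lead_coeff g0 * c = 1"
    using p0 by (simp add: degree_cyclotomic_prime coeff_cyclotomic_prime)
  hence "g0 = cyclotomic_prime p * [:Polynomial.lead_coeff g0:]"
    unfolding q c by (simp add: mult.commute)
  hence "cyclotomic_prime p dvd g0" by (rule dvdI)
  with dvd[OF f] show ?thesis by (rule dvd_trans[rotated])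
qed

text \<open>This is conjugacy of the nontrivial roots of unity, and it is what makes the
  automorphisms below well defined.\<close>

lemma int_eval_eq_0_conj:
  fixes z w :: "'a :: {idom, ring_char_0}"
  assumes p: "Factorial_Ring.prime p" and "z ^ p = 1" "z \<noteq> 1" "w ^ p = 1" "w \<noteq> 1"
  shows "int_eval f z = 0 \<longleftrightarrow> int_eval f w = 0"
proof -
  have *: "int_eval f v = 0" if "int_eval f u = 0" "u ^ p = 1" "u \<noteq> 1" "v ^ p = 1" "v \<noteq> 1" for u v :: 'a
    using cyclotomic_prime_dvd[OF p that(2,3,1)] that(4,5)
    by (auto elim!: dvdE simp: int_eval_cyclotomic_prime)
  from assms show ?thesis by (metis *)
qed

section \<open>Galois group and trace form\<close>

text \<open>For prime \<open>p\<close> these are exactly the primitive \<open>p\<close>-th roots of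
  unity.\<close>

definition prim_roots :: "nat \<Rightarrow> complex set" where
  "prim_roots p = {z. z ^ p = 1 \<and> z \<noteq> 1}"

lemma zeta_in_prim_roots:
  assumes "p > 1"
  shows "zeta p \<in> prim_roots p"
proof -
  have eq: "zeta p = exp (2 * of_real pi * \<i> * of_nat 1 / of_nat p)" by (simp add: zeta_def)
  have "zeta p ^ p = 1" unfolding eq using assms by (intro complex_root_unity) auto
  moreover have "zeta p \<noteq> 1" unfolding eq using assms
    by (subst complex_root_unity_eq_1) auto
  ultimately show ?thesis by (simp add: prim_roots_def)
qed

lemma root_power_eq_1_iff:
  assumes p: "Factorial_Ring.prime p" and z: "z \<in> prim_roots p"
  shows "z ^ k = 1 \<longleftrightarrow> p dvd k"
proof
  assume "p dvd k"
  thus "z ^ k = 1" using z by (auto simp: prim_roots_def power_mult elim!: dvdE)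
next
  assume k: "z ^ k = 1"
  show "p dvd k"
  proof (rule ccontr)
    assume "\<not> p dvd k"
    hence "coprime p k" using p by (simp add: prime_imp_coprime)
    hence "gcd p k = 1" by simp
    moreover have "p \<noteq> 0" using p by auto
    \<comment> \<open>With this Bezout relation z^(p u) = 1 and z^(k v + 1) = z, which would force z
      = 1.\<close>
    ultimately obtain u v where uv: "p * u = k * v + 1"
      using bezout_nat[of p k] by auto
    have "z ^ (p * u) = 1" using z by (simp add: power_mult prim_roots_def)
    moreover have "z ^ (k * v + 1) = z" using k by (simp add: power_mult)
    ultimately show False using z uv by (simp add: prim_roots_def)
  qed
qed

text \<open>The powers of \<open>z\<close> with exponents below \<open>p\<close> are distinct, so
  they exhaust the \<open>p\<close> solutions of u^p = 1.\<close>

lemma prim_roots_power_surj: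
  assumes p: "Factorial_Ring.prime p" and z: "z \<in> prim_roots p" and w: "w \<in> prim_roots p"
  obtains k where "w = z ^ k"
proof -
  have p0: "p > 0" using p prime_gt_0_nat by auto
  have "z \<noteq> 0" using z p0 by (auto simp: prim_roots_def power_0_left)
  have *: False if "z ^ i = z ^ j" "i < j" "j < p" for i j
  proof -
    have "z ^ (j - i) = 1" using that \<open>z \<noteq> 0\<close> by (simp add: power_diff)
    hence "p dvd j - i" by (simp add: root_power_eq_1_iff[OF p z])
    thus False using that by (auto dest!: dvd_imp_le)
  qed
  have inj: "inj_on (\<lambda>k. z ^ k) {..<p}"
    by (intro inj_onI) (metis * lessThan_iff linorder_neqE_nat)
  have "(\<lambda>k. z ^ k) ` {..<p} = {u. u ^ p = 1}"
  proof (rule card_subset_eq)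
    show "finite {u :: complex. u ^ p = 1}" using p0 by (intro finite_roots_unity) auto
    show "(\<lambda>k. z ^ k) ` {..<p} \<subseteq> {u. u ^ p = 1}"
      using z by (auto simp: prim_roots_def simp flip: power_mult)
         (metis mult.commute power_mult power_one)
    show "card ((\<lambda>k. z ^ k) ` {..<p}) = card {u :: complex. u ^ p = 1}"
      using p0 inj by (simp add: card_image card_roots_unity_eq)
  qed
  moreover have "w \<in> {u. u ^ p = 1}" using w by (simp add: prim_roots_def)
  ultimately show ?thesis using that by blast
qed

text \<open>Over all \<open>p\<close>-th roots of unity, multiplication by \<open>zeta p\<close>
  permutes the summands and scales the sum by a factor other than 1 unless \<open>p\<close> divides
  \<open>m\<close>. Removing the root 1 gives the summand - 1.\<close>

lemma sum_prim_roots_power: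
  assumes p: "Factorial_Ring.prime p"
  shows "(\<Sum>z\<in>prim_roots p. z ^ m) = (if p dvd m then of_nat p else 0) - 1"
proof -
  let ?T = "{z :: complex. z ^ p = 1}"
  have p1: "p > 1" using p prime_gt_1_nat by auto
  have fin: "finite ?T" using p1 by (intro finite_roots_unity) auto
  have T: "?T = insert 1 (prim_roots p)" by (auto simp: prim_roots_def)
  have finR: "finite (prim_roots p)" using fin by (simp add: T)
  have eq: "(\<Sum>z\<in>?T. z ^ m) = 1 + (\<Sum>z\<in>prim_roots p. z ^ m)"
    unfolding T using finR by (subst sum.insert) (auto simp: prim_roots_def)
  have "(\<Sum>z\<in>?T. z ^ m) = (if p dvd m then of_nat p else 0)"
  proof (cases "p dvd m")
    case True
    hence "(\<Sum>z\<in>?T. z ^ m) = (\<Sum>z\<in>?T. 1)"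
      by (intro sum.cong) (auto simp: power_mult elim!: dvdE)
    thus ?thesis using True p1 by (simp add: card_roots_unity_eq)
  next
    case False
    define w where "w = zeta p"
    have w: "w \<in> prim_roots p" using zeta_in_prim_roots p1 by (simp add: w_def)
    have "w \<noteq> 0" using w p1 by (auto simp: prim_roots_def power_0_left)
    have "bij_betw (\<lambda>z. w * z) ?T ?T"
      using w \<open>w \<noteq> 0\<close>
      by (intro bij_betwI[where g = "\<lambda>z. z / w"]) (auto simp: prim_roots_def power_mult_distrib power_divide)
    hence "(\<Sum>z\<in>?T. z ^ m) = (\<Sum>z\<in>?T. (w * z) ^ m)"
      by (rule sum.reindex_bij_betw[symmetric])
    also have "\<dots> = w ^ m * (\<Sum>z\<in>?T. z ^ m)" by (simp add: power_mult_distrib sum_distrib_left)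
    finally have "(1 - w ^ m) * (\<Sum>z\<in>?T. z ^ m) = 0" by (simp add: algebra_simps)
    moreover have "w ^ m \<noteq> 1" using False root_power_eq_1_iff[OF p w] by simp
    ultimately show ?thesis using False by simp
  qed
  thus ?thesis using eq by (simp add: algebra_simps)
qed

section \<open>Elements of the cyclotomic field as fractions of integer polynomials\<close>

lemma type_ring_simps [simp]:
  "carrier (ring_of_type_algebra :: complex ring) = UNIV"
  "x \<otimes>\<^bsub>ring_of_type_algebra\<^esub> y = x * (y :: complex)"
  "x \<oplus>\<^bsub>ring_of_type_algebra\<^esub> y = x + (y :: complex)"
  "\<one>\<^bsub>ring_of_type_algebra\<^esub> = (1 :: complex)"
  "\<zero>\<^bsub>ring_of_type_algebra\<^esub> = (0 :: complex)"
  by (simp_all add: ring_of_type_algebra_def)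

lemma type_ring_a_inv [simp]: "\<ominus>\<^bsub>ring_of_type_algebra\<^esub> x = - (x :: complex)"
proof -
  interpret field "ring_of_type_algebra :: complex ring" by (rule field_from_type_algebra)
  show ?thesis by (rule minus_equality) auto
qed

lemma type_ring_m_inv [simp]:
  assumes "x \<noteq> 0"
  shows "inv\<^bsub>ring_of_type_algebra\<^esub> x = inverse (x :: complex)"
proof -
  interpret field "ring_of_type_algebra :: complex ring" by (rule field_from_type_algebra)
  show ?thesis using assms by (intro comm_inv_char) auto
qed

lemma cyclotomic_field_subfield:
  shows cyclotomic_field_Rats: "q \<in> \<rat> \<Longrightarrow> q \<in> cyclotomic_field p"
    and cyclotomic_field_zeta: "zeta p \<in> cyclotomic_field p"
    and cyclotomic_field_add: "x \<in> cyclotomic_field p \<Longrightarrow> y \<in> cyclotomic_field p \<Longrightarrow> x + y \<in> cyclotomic_field p"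
    and cyclotomic_field_mult: "x \<in> cyclotomic_field p \<Longrightarrow> y \<in> cyclotomic_field p \<Longrightarrow> x * y \<in> cyclotomic_field p"
    and cyclotomic_field_inverse: "x \<in> cyclotomic_field p \<Longrightarrow> inverse x \<in> cyclotomic_field p"
proof -
  let ?K = "generate_field (ring_of_type_algebra :: complex ring) (\<rat> \<union> {zeta p})"
  show "q \<in> \<rat> \<Longrightarrow> q \<in> cyclotomic_field p" "zeta p \<in> cyclotomic_field p"
    unfolding cyclotomic_field_def by (auto intro: generate_field.incl)
  show "x \<in> cyclotomic_field p \<Longrightarrow> y \<in> cyclotomic_field p \<Longrightarrow> x + y \<in> cyclotomic_field p"
    unfolding cyclotomic_field_def using generate_field.eng_add[of x "ring_of_type_algebra" _ y] by simp
  show "x \<in> cyclotomic_field p \<Longrightarrow> y \<in> cyclotomic_field p \<Longrightarrow> x * y \<in> cyclotomic_field p"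
    unfolding cyclotomic_field_def using generate_field.eng_mult[of x "ring_of_type_algebra" _ y] by simp
  show "inverse x \<in> cyclotomic_field p" if "x \<in> cyclotomic_field p"
  proof (cases "x = 0")
    case False
    thus ?thesis using that generate_field.m_inv[of x "ring_of_type_algebra"]
      unfolding cyclotomic_field_def by simp
  qed (use that in simp)
qed

lemma int_eval_in_cyclotomic_field:
  assumes "z \<in> cyclotomic_field p"
  shows "int_eval f z \<in> cyclotomic_field p"
  by (induction f) (auto intro!: cyclotomic_field_add cyclotomic_field_mult assms intro: cyclotomic_field_Rats)

text \<open>The pair is kept rather than its value, so that the same fraction can be evaluated at
  conjugate roots.\<close>

definition frac_eval :: "int poly \<times> int poly \<Rightarrow> complex \<Rightarrow> complex" where
  "frac_eval r z = int_eval (fst r) z / int_eval (snd r) z"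

text \<open>Such fractions contain the rationals, as quotients of constants, and
  \<open>zeta p\<close>, and they are closed under the field operations, so nothing else is
  generated.\<close>

lemma cyclotomic_field_eq:
  "cyclotomic_field p = {frac_eval r (zeta p) | r. int_eval (snd r) (zeta p) \<noteq> 0}" (is "_ = ?F")
proof (intro equalityI subsetI)
  fix x assume "x \<in> ?F"
  then obtain f g where x: "x = int_eval f (zeta p) / int_eval g (zeta p)"
    by (auto simp: frac_eval_def)
  show "x \<in> cyclotomic_field p"
    unfolding x divide_inverse
    by (intro cyclotomic_field_mult cyclotomic_field_inverse int_eval_in_cyclotomic_field cyclotomic_field_zeta)
next
  let ?w = "zeta p"
  have F: "int_eval f ?w / int_eval g ?w \<in> ?F" if "int_eval g ?w \<noteq> 0" for f g
    using that by (intro CollectI exI[of _ "(f, g)"]) (simp add: frac_eval_def)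
  fix x assume "x \<in> cyclotomic_field p"
  hence "x \<in> generate_field (ring_of_type_algebra :: complex ring) (\<rat> \<union> {zeta p})"
    by (simp add: cyclotomic_field_def)
  thus "x \<in> ?F"
  proof (induction rule: generate_field.induct)
    case one
    show ?case using F[of 1 1] by simp
  next
    case (incl h)
    show ?case
    proof (cases "h = ?w")
      case True
      thus ?thesis using F[of 1 "[:0, 1:]"] by simp
    next
      case False
      with incl have "h \<in> \<rat>" by simp
      then obtain a b :: int where "b > 0" "h = of_int a / of_int b"
        by (elim Rats_cases') auto
      thus ?thesis using F[of "[:b:]" "[:a:]"] by simp
    qed
  next
    case (a_inv h)
    then obtain f g where "h = int_eval f ?w / int_eval g ?w" "int_eval g ?w \<noteq> 0"
      by (auto simp: frac_eval_def)
    thus ?case using F[of g "-f"] by simp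
  next
    case (m_inv h)
    then obtain f g where "h = int_eval f ?w / int_eval g ?w" "int_eval g ?w \<noteq> 0"
      by (auto simp: frac_eval_def)
    thus ?case using m_inv F[of f g] by (simp add: inverse_eq_divide)
  next
    case (eng_add h1 h2)
    then obtain f1 g1 f2 g2 where
        "h1 = int_eval f1 ?w / int_eval g1 ?w" "int_eval g1 ?w \<noteq> 0"
        "h2 = int_eval f2 ?w / int_eval g2 ?w" "int_eval g2 ?w \<noteq> 0"
      by (auto simp: frac_eval_def)
    thus ?case using F[of "g1 * g2" "f1 * g2 + f2 * g1"] by (simp add: add_frac_eq)
  next
    case (eng_mult h1 h2)
    then obtain f1 g1 f2 g2 where
        "h1 = int_eval f1 ?w / int_eval g1 ?w" "int_eval g1 ?w \<noteq> 0"
        "h2 = int_eval f2 ?w / int_eval g2 ?w" "int_eval g2 ?w \<noteq> 0"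
      by (auto simp: frac_eval_def)
    thus ?case using F[of "g1 * g2" "f1 * f2"] by simp
  qed
qed


lemma frac_eval_in_cyclotomic_field:
  "int_eval (snd r) (zeta p) \<noteq> 0 \<Longrightarrow> frac_eval r (zeta p) \<in> cyclotomic_field p"
  unfolding cyclotomic_field_eq by blast

lemma frac_eval_power:
  "frac_eval (pcompose (fst r) (Polynomial.monom 1 k), pcompose (snd r) (Polynomial.monom 1 k)) z
     = frac_eval r (z ^ k)"
  by (simp add: frac_eval_def int_eval_pcompose)

section \<open>Automorphisms correspond to primitive roots of unity\<close>

context
  fixes p :: nat
  assumes p: "Factorial_Ring.prime p"
begin

lemma zeta_prim_root: "zeta p \<in> prim_roots p"
  using prime_gt_1_nat[OF p] by (rule zeta_in_prim_roots)

lemma int_eval_prim_roots: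
  assumes "w \<in> prim_roots p" "z \<in> prim_roots p"
  shows "int_eval f w = 0 \<longleftrightarrow> int_eval f z = 0"
  using assms int_eval_eq_0_conj[OF p, of w z f] by (simp add: prim_roots_def)

text \<open>After cross-multiplication an equality of fractions is the vanishing of one integer
  polynomial, which does not depend on the chosen root.\<close>

lemma frac_eval_prim_roots:
  assumes wz: "w \<in> prim_roots p" "z \<in> prim_roots p"
    and nz: "int_eval (snd r) w \<noteq> 0" "int_eval (snd s) w \<noteq> 0"
  shows "frac_eval r w = frac_eval s w \<longleftrightarrow> frac_eval r z = frac_eval s z"
proof -
  note * = int_eval_prim_roots[OF wz]
  from nz have nz': "int_eval (snd r) z \<noteq> 0" "int_eval (snd s) z \<noteq> 0" by (simp_all add: *)
  show ?thesis
    using *[of "fst r * snd s - fst s * snd r"] nz nz'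
    by (simp add: frac_eval_def frac_eq_eq)
qed

text \<open>This is the automorphism sending \<open>zeta p\<close> to \<open>z\<close>: write an
  element as a fraction in \<open>zeta p\<close> and evaluate that fraction at \<open>z\<close>. The
  restriction supplies the extensionality demanded by \<open>galois_group\<close>.\<close>

definition conj_map :: "complex \<Rightarrow> complex \<Rightarrow> complex" where
  "conj_map z = restrict (\<lambda>x. frac_eval (SOME r. int_eval (snd r) (zeta p) \<noteq> 0 \<and> x = frac_eval r (zeta p)) z)
     (cyclotomic_field p)"

lemma conj_map_frac_eval:
  assumes z: "z \<in> prim_roots p" and r: "int_eval (snd r) (zeta p) \<noteq> 0"
  shows "conj_map z (frac_eval r (zeta p)) = frac_eval r z"
proof -
  define s where "s = (SOME s. int_eval (snd s) (zeta p) \<noteq> 0 \<and> frac_eval r (zeta p) = frac_eval s (zeta p))"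
  have s: "int_eval (snd s) (zeta p) \<noteq> 0 \<and> frac_eval r (zeta p) = frac_eval s (zeta p)"
    unfolding s_def by (rule someI[of _ r]) (use r in simp)
  have "frac_eval r (zeta p) \<in> cyclotomic_field p"
    using r by (rule frac_eval_in_cyclotomic_field)
  hence "conj_map z (frac_eval r (zeta p)) = frac_eval s z"
    unfolding conj_map_def s_def by simp
  also have "\<dots> = frac_eval r z"
    using frac_eval_prim_roots[OF zeta_prim_root z r, of s] s by simp
  finally show ?thesis .
qed

lemma conj_map_int_eval:
  assumes "z \<in> prim_roots p"
  shows "conj_map z (int_eval f (zeta p)) = int_eval f z"
  using conj_map_frac_eval[OF assms, of "(f, 1)"] by (simp add: frac_eval_def)

text \<open>Since \<open>z\<close> is a power of \<open>zeta p\<close>, values stay in the field;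
  since \<open>zeta p\<close> is a power of \<open>z\<close>, every element is attained. Homomorphy
  and injectivity follow by computing with representing fractions.\<close>

lemma conj_map_in_galois_group:
  assumes z: "z \<in> prim_roots p"
  shows "conj_map z \<in> galois_group p"
proof -
  let ?w = "zeta p" and ?K = "cyclotomic_field p"
  note conj = conj_map_frac_eval[OF z]
  note nz = int_eval_prim_roots[OF zeta_prim_root z]
  obtain k where k: "z = ?w ^ k" using prim_roots_power_surj[OF p zeta_prim_root z] .
  obtain m where m: "?w = z ^ m" using prim_roots_power_surj[OF p z zeta_prim_root] .
  have K: "\<exists>r. x = frac_eval r ?w \<and> int_eval (snd r) ?w \<noteq> 0" if "x \<in> ?K" for x
    using that by (auto simp: cyclotomic_field_eq)
  have closed: "conj_map z x \<in> ?K" if x: "x \<in> ?K" for x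
  proof -
    from K[OF x] obtain r where r: "x = frac_eval r ?w" "int_eval (snd r) ?w \<noteq> 0" by blast
    have "z \<in> ?K" unfolding k using int_eval_in_cyclotomic_field[OF cyclotomic_field_zeta, of "Polynomial.monom 1 k"]
      by simp
    thus ?thesis unfolding r(1) conj[OF r(2)] unfolding frac_eval_def divide_inverse
      by (intro cyclotomic_field_mult cyclotomic_field_inverse int_eval_in_cyclotomic_field)
  qed
  have add: "conj_map z (x + y) = conj_map z x + conj_map z y"
    and mult: "conj_map z (x * y) = conj_map z x * conj_map z y" if x: "x \<in> ?K" and y: "y \<in> ?K" for x y
  proof -
    from K[OF x] obtain r where r: "x = frac_eval r ?w" "int_eval (snd r) ?w \<noteq> 0" by blast
    from K[OF y] obtain s where s: "y = frac_eval s ?w" "int_eval (snd s) ?w \<noteq> 0" by blast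
    have nz': "int_eval (snd r) z \<noteq> 0" "int_eval (snd s) z \<noteq> 0" using r s by (simp_all add: nz)
    have "x + y = frac_eval (fst r * snd s + fst s * snd r, snd r * snd s) ?w"
      using r s by (simp add: frac_eval_def add_frac_eq)
    thus "conj_map z (x + y) = conj_map z x + conj_map z y"
      using r s nz' by (simp add: conj) (simp add: frac_eval_def add_frac_eq)
    have "x * y = frac_eval (fst r * fst s, snd r * snd s) ?w"
      using r s by (simp add: frac_eval_def)
    thus "conj_map z (x * y) = conj_map z x * conj_map z y"
      using r s nz' by (simp add: conj) (simp add: frac_eval_def)
  qed
  have inj: "inj_on (conj_map z) ?K"
  proof (rule inj_onI)
    fix x y assume xy: "x \<in> ?K" "y \<in> ?K" "conj_map z x = conj_map z y"
    from K[OF xy(1)] obtain r where r: "x = frac_eval r ?w" "int_eval (snd r) ?w \<noteq> 0" by blast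
    from K[OF xy(2)] obtain s where s: "y = frac_eval s ?w" "int_eval (snd s) ?w \<noteq> 0" by blast
    show "x = y"
      using xy(3) frac_eval_prim_roots[OF zeta_prim_root z r(2) s(2)] r s by (simp add: conj)
  qed
  have surj: "x \<in> conj_map z ` ?K" if "x \<in> ?K" for x
  proof -
    from K[OF that] obtain r where r: "x = frac_eval r ?w" "int_eval (snd r) ?w \<noteq> 0" by blast
    \<comment> \<open>Substituting X^m into the fraction yields a preimage, because its value at
      \<open>z\<close> is the value of \<open>r\<close> at z^m = \<open>zeta p\<close>.\<close>
    define s where "s = (pcompose (fst r) (Polynomial.monom 1 m), pcompose (snd r) (Polynomial.monom 1 m))"
    have "int_eval (snd s) z \<noteq> 0"
      using r(2) by (simp add: s_def int_eval_pcompose flip: m)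
    hence s: "int_eval (snd s) ?w \<noteq> 0" by (simp add: nz)
    have "x = conj_map z (frac_eval s ?w)"
      unfolding conj[OF s] unfolding r(1) s_def frac_eval_power by (simp flip: m)
    moreover have "frac_eval s ?w \<in> ?K" using s by (rule frac_eval_in_cyclotomic_field)
    ultimately show ?thesis by blast
  qed
  have Rats: "conj_map z q = q" if q: "q \<in> \<rat>" for q
  proof -
    obtain a b :: int where "b > 0" "q = of_int a / of_int b"
      using q by (elim Rats_cases') auto
    thus ?thesis using conj[of "([:a:], [:b:])"] by (simp add: frac_eval_def)
  qed
  have "conj_map z \<in> ring_hom (cyclotomic_ring p) (cyclotomic_ring p)"
    by (rule ring_hom_memI) (auto simp: cyclotomic_ring_def closed add mult Rats)
  moreover have "bij_betw (conj_map z) ?K ?K"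
    using inj closed surj by (auto simp: bij_betw_def)
  moreover have "conj_map z \<in> extensional ?K" by (simp add: conj_map_def)
  ultimately show ?thesis
    using Rats by (simp add: galois_group_def ring_iso_def cyclotomic_ring_def)
qed

text \<open>An automorphism fixes the rationals, so it commutes with integer polynomials and is
  determined by the image of \<open>zeta p\<close>. Injectivity keeps this image away from
  1.\<close>

lemma galois_group_eq_conj_map:
  assumes \<sigma>: "\<sigma> \<in> galois_group p"
  shows "\<sigma> (zeta p) \<in> prim_roots p" and "\<sigma> = conj_map (\<sigma> (zeta p))"
proof -
  let ?w = "zeta p" and ?K = "cyclotomic_field p"
  have hom: "\<sigma> \<in> ring_hom (cyclotomic_ring p) (cyclotomic_ring p)" and inj: "inj_on \<sigma> ?K"
    and ext: "\<sigma> \<in> extensional ?K" and Rats: "\<And>q. q \<in> \<rat> \<Longrightarrow> \<sigma> q = q"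
    using \<sigma> by (auto simp: galois_group_def ring_iso_def cyclotomic_ring_def bij_betw_def)
  have mult: "\<sigma> (x * y) = \<sigma> x * \<sigma> y" if "x \<in> ?K" "y \<in> ?K" for x y
    using ring_hom_mult[OF hom, of x y] that by (simp add: cyclotomic_ring_def)
  have add: "\<sigma> (x + y) = \<sigma> x + \<sigma> y" if "x \<in> ?K" "y \<in> ?K" for x y
    using ring_hom_add[OF hom, of x y] that by (simp add: cyclotomic_ring_def)
  note K = int_eval_in_cyclotomic_field[OF cyclotomic_field_zeta]
  have eval: "\<sigma> (int_eval f ?w) = int_eval f (\<sigma> ?w)" for f
    by (induction f)
       (simp_all add: add mult cyclotomic_field_mult cyclotomic_field_Rats cyclotomic_field_zeta K Rats)
  have "\<sigma> ?w ^ p = 1"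
    using eval[of "Polynomial.monom 1 p"] zeta_prim_root by (simp add: Rats prim_roots_def)
  moreover have "\<sigma> ?w \<noteq> \<sigma> 1"
    using inj zeta_prim_root by (auto simp: inj_on_eq_iff cyclotomic_field_zeta cyclotomic_field_Rats prim_roots_def)
  ultimately show z: "\<sigma> ?w \<in> prim_roots p" by (simp add: prim_roots_def Rats)
  show "\<sigma> = conj_map (\<sigma> ?w)"
  proof (rule extensionalityI[OF ext])
    show "conj_map (\<sigma> ?w) \<in> extensional ?K" by (simp add: conj_map_def)
    fix x assume "x \<in> ?K"
    then obtain r where r: "x = frac_eval r ?w" "int_eval (snd r) ?w \<noteq> 0"
      by (auto simp: cyclotomic_field_eq)
    have "int_eval (snd r) (\<sigma> ?w) \<noteq> 0" using r(2) int_eval_prim_roots[OF zeta_prim_root z] by simp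
    moreover have "\<sigma> x * \<sigma> (int_eval (snd r) ?w) = \<sigma> (int_eval (fst r) ?w)"
      using r \<open>x \<in> ?K\<close> by (subst mult[symmetric]) (simp_all add: K frac_eval_def)
    ultimately show "\<sigma> x = conj_map (\<sigma> ?w) x"
      unfolding r(1) conj_map_frac_eval[OF z r(2)] by (simp add: eval frac_eval_def field_simps)
  qed
qed

section \<open>Traces and norms in coordinates\<close>

lemma cyc_trace_int_eval:
  "cyc_trace p (int_eval f (zeta p)) = (\<Sum>z\<in>prim_roots p. int_eval f z)"
proof -
  have "bij_betw conj_map (prim_roots p) (galois_group p)"
  proof (rule bij_betwI[where g = "\<lambda>\<sigma>. \<sigma> (zeta p)"])
    show "conj_map \<in> prim_roots p \<rightarrow> galois_group p"
      using conj_map_in_galois_group by auto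
    show "(\<lambda>\<sigma>. \<sigma> (zeta p)) \<in> galois_group p \<rightarrow> prim_roots p"
      using galois_group_eq_conj_map(1) by auto
    show "conj_map z (zeta p) = z" if "z \<in> prim_roots p" for z
      using conj_map_int_eval[OF that, of "[:0, 1:]"] by simp
    show "conj_map (\<sigma> (zeta p)) = \<sigma>" if "\<sigma> \<in> galois_group p" for \<sigma>
      using galois_group_eq_conj_map(2)[OF that] by simp
  qed
  hence "cyc_trace p (int_eval f (zeta p)) = (\<Sum>z\<in>prim_roots p. conj_map z (int_eval f (zeta p)))"
    unfolding cyc_trace_def by (rule sum.reindex_bij_betw[symmetric])
  also have "\<dots> = (\<Sum>z\<in>prim_roots p. int_eval f z)"
    by (intro sum.cong) (auto simp: conj_map_int_eval)
  finally show ?thesis .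
qed

text \<open>The exponent \<open>i + j\<close> lies strictly between 0 and 2p, so it is a multiple of
  \<open>p\<close> only for \<open>i = p - j\<close>. That power has trace p - 1 and all others have
  trace - 1.\<close>

lemma cyc_trace_coords:
  fixes c :: "nat \<Rightarrow> int"
  assumes j: "j \<in> {1..p-1}"
  shows "cyc_trace p ((\<Sum>i=1..p-1. of_int (c i) * zeta p ^ i) * zeta p ^ j)
       = of_int (int p * c (p - j) - (\<Sum>i=1..p-1. c i))"
proof -
  let ?f = "\<Sum>i=1..p-1. Polynomial.monom (c i) (i + j)"
  have eq: "(\<Sum>i=1..p-1. of_int (c i) * zeta p ^ i) * zeta p ^ j = int_eval ?f (zeta p)"
    by (simp add: sum_distrib_right power_add mult.assoc)
  have "cyc_trace p ((\<Sum>i=1..p-1. of_int (c i) * zeta p ^ i) * zeta p ^ j)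
      = (\<Sum>z\<in>prim_roots p. \<Sum>i=1..p-1. of_int (c i) * z ^ (i + j))"
    unfolding eq cyc_trace_int_eval by simp
  also have "\<dots> = (\<Sum>i=1..p-1. of_int (c i) * (\<Sum>z\<in>prim_roots p. z ^ (i + j)))"
    by (subst sum.swap) (simp add: sum_distrib_left)
  also have "\<dots> = (\<Sum>i=1..p-1. (if i = p - j then of_nat p * of_int (c i) else 0) - of_int (c i))"
  proof (intro sum.cong refl)
    fix i assume i: "i \<in> {1..p-1}"
    have "p dvd i + j \<longleftrightarrow> i = p - j"
    proof
      assume "p dvd i + j"
      then obtain k where k: "i + j = p * k" by (elim dvdE)
      have "0 < p * k" "p * k < p * 2" using i j unfolding k[symmetric] by auto
      hence "k = 1" by simp
      thus "i = p - j" using k by simp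
    qed (use j in auto)
    thus "of_int (c i) * (\<Sum>z\<in>prim_roots p. z ^ (i + j))
        = (if i = p - j then of_nat p * of_int (c i) else 0) - (of_int (c i) :: complex)"
      unfolding sum_prim_roots_power[OF p] by (simp add: algebra_simps)
  qed
  also have "\<dots> = of_int (int p * c (p - j) - (\<Sum>i=1..p-1. c i))"
  proof -
    have "1 \<le> p - j" "p - j \<le> p - 1" using j by auto
    thus ?thesis by (simp add: sum_subtractf)
  qed
  finally show ?thesis .
qed

text \<open>With \<open>s\<close> the coordinate sum, expanding the squared traces gives the
  coefficient - 2p + (p - 1) = - (p + 1) for s^2.\<close>

lemma cyc_norm_coords:
  fixes c :: "nat \<Rightarrow> int"
  shows "cyc_norm p (\<Sum>i=1..p-1. of_int (c i) * zeta p ^ i)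
       = sqrt ((real p)\<^sup>2 * (\<Sum>i=1..p-1. (of_int (c i))\<^sup>2) - (real p + 1) * (\<Sum>i=1..p-1. of_int (c i))\<^sup>2)"
proof -
  define s where "s = (\<Sum>i=1..p-1. c i)"
  have p1: "p > 1" using prime_gt_1_nat[OF p] .
  have "(\<Sum>j=1..p-1. (cyc_trace p ((\<Sum>i=1..p-1. of_int (c i) * zeta p ^ i) * zeta p ^ j))\<^sup>2)
     = (\<Sum>j=1..p-1. of_int ((int p * c (p - j) - s)\<^sup>2))"
    by (intro sum.cong refl, subst cyc_trace_coords) (auto simp: s_def)
  also have "\<dots> = (\<Sum>j=1..p-1. of_int ((int p * c j - s)\<^sup>2))"
    \<comment> \<open>The reflection \<open>j\<close> to \<open>p - j\<close> permutes the index
      range, so the reversed coordinate in the trace formula is harmless.\<close>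
    by (rule sum.reindex_bij_witness[of _ "\<lambda>j. p - j" "\<lambda>j. p - j"]) auto
  also have "\<dots> = of_int (\<Sum>j=1..p-1. (int p * c j - s)\<^sup>2)" by simp
  also have "(\<Sum>j=1..p-1. (int p * c j - s)\<^sup>2) = (\<Sum>j=1..p-1. (int p)\<^sup>2 * (c j)\<^sup>2 - (2 * int p * s) * c j + s\<^sup>2)"
    by (intro sum.cong) (auto simp: power2_eq_square algebra_simps)
  also have "\<dots> = (int p)\<^sup>2 * (\<Sum>j=1..p-1. (c j)\<^sup>2) - (2 * int p * s) * s + (int p - 1) * s\<^sup>2"
    unfolding s_def[symmetric] using p1
    by (simp add: sum.distrib sum_subtractf of_nat_diff flip: sum_distrib_left) (simp add: s_def)
  also have "\<dots> = (int p)\<^sup>2 * (\<Sum>j=1..p-1. (c j)\<^sup>2) - (int p + 1) * s\<^sup>2"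
    by (simp add: power2_eq_square algebra_simps)
  finally show ?thesis
    unfolding cyc_norm_def by (simp add: s_def)
qed

text \<open>All traces of 0 vanish, so each coordinate times \<open>p\<close> equals the coordinate
  sum \<open>s\<close>. Summing over the p - 1 coordinates gives p s = (p - 1) s, hence s = 0. This
  independence makes different sign patterns give different vertices.\<close>

lemma coords_eq_0:
  fixes c :: "nat \<Rightarrow> int"
  assumes "(\<Sum>i=1..p-1. of_int (c i) * zeta p ^ i) = 0" and "i \<in> {1..p-1}"
  shows "c i = 0"
proof -
  define s where "s = (\<Sum>i=1..p-1. c i)"
  have p1: "p > 1" using prime_gt_1_nat[OF p] .
  have *: "int p * c i = s" if i: "i \<in> {1..p-1}" for i
  proof -
    have "of_int (int p * c (p - (p - i)) - s)
        = cyc_trace p ((\<Sum>i=1..p-1. of_int (c i) * zeta p ^ i) * zeta p ^ (p - i))"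
      unfolding s_def using i by (intro cyc_trace_coords[symmetric]) auto
    also have "\<dots> = cyc_trace p (int_eval 0 (zeta p))" unfolding assms(1) by simp
    also have "\<dots> = 0" unfolding cyc_trace_int_eval by simp
    finally have "int p * c (p - (p - i)) = s" by (simp del: of_int_diff of_int_mult)
    moreover have "p - (p - i) = i" using i by auto
    ultimately show ?thesis by simp
  qed
  have "int p * s = (\<Sum>i=1..p-1. int p * c i)" by (simp add: s_def sum_distrib_left)
  also have "\<dots> = (\<Sum>i=1..p-1. s)" by (intro sum.cong) (auto simp: *)
  also have "\<dots> = (int p - 1) * s" using p1 by (simp add: of_nat_diff)
  finally have "s = 0" by (simp add: algebra_simps)
  with *[OF assms(2)] p1 show ?thesis by simp
qed

end

section \<open>Quadratic forms in random signs\<close>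

text \<open>Extensionality represents each sign pattern by exactly one function, so that counting is
  correct.\<close>

definition signs :: "'i set \<Rightarrow> ('i \<Rightarrow> int) set" where
  "signs I = PiE I (\<lambda>_. {-1, 1})"

definition sign_mean :: "'i set \<Rightarrow> (('i \<Rightarrow> int) \<Rightarrow> real) \<Rightarrow> real" where
  "sign_mean I f = (\<Sum>e\<in>signs I. f e) / 2 ^ card I"

lemma finite_signs: "finite I \<Longrightarrow> finite (signs I)"
  by (auto simp: signs_def intro!: finite_PiE)

lemma card_signs: "finite I \<Longrightarrow> card (signs I) = 2 ^ card I"
  by (simp add: signs_def card_PiE numeral_2_eq_2)

lemma sign_mean_add: "sign_mean I (\<lambda>e. f e + g e) = sign_mean I f + sign_mean I g"
  by (simp add: sign_mean_def sum.distrib add_divide_distrib)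

lemma sign_mean_cmult: "sign_mean I (\<lambda>e. c * f e) = c * sign_mean I f"
  by (simp add: sign_mean_def sum_distrib_left)

lemma sign_mean_const: "finite I \<Longrightarrow> sign_mean I (\<lambda>e. c) = c"
  by (simp add: sign_mean_def card_signs)

lemma sign_mean_mono:
  "(\<And>e. e \<in> signs I \<Longrightarrow> f e \<le> g e) \<Longrightarrow> sign_mean I f \<le> sign_mean I g"
  by (auto simp: sign_mean_def intro!: divide_right_mono sum_mono)

lemma sign_mean_cong:
  "(\<And>e. e \<in> signs I \<Longrightarrow> f e = g e) \<Longrightarrow> sign_mean I f = sign_mean I g"
  by (auto simp: sign_mean_def intro!: sum.cong)

text \<open>Averaging first over the new sign is the form of independence on which the moment
  computations by induction rest.\<close>

lemma sign_mean_insert: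
  assumes "finite I" "k \<notin> I"
  shows "sign_mean (insert k I) f
       = sign_mean I (\<lambda>e. (f (e(k := -1)) + f (e(k := 1))) / 2)"
proof -
  have inj: "inj_on (\<lambda>(y, g). g(k := y)) ({-1, 1} \<times> signs I)"
    using assms unfolding signs_def by (intro inj_combinator) auto
  have "(\<Sum>e\<in>signs (insert k I). f e) = (\<Sum>(y, e)\<in>{-1, 1} \<times> signs I. f (e(k := y)))"
    using sum.reindex[OF inj, of f] by (simp add: signs_def PiE_insert_eq case_prod_unfold)
  also have "\<dots> = (\<Sum>y\<in>{-1, 1}. \<Sum>e\<in>signs I. f (e(k := y)))"
    by (rule sum.cartesian_product[symmetric])
  also have "\<dots> = (\<Sum>e\<in>signs I. f (e(k := -1)) + f (e(k := 1)))"
    by (simp add: sum.distrib)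
  finally show ?thesis
    using assms by (simp add: sign_mean_def sum_divide_distrib mult_ac)
qed

definition lin :: "'i set \<Rightarrow> ('i \<Rightarrow> real) \<Rightarrow> ('i \<Rightarrow> int) \<Rightarrow> real" where
  "lin I c e = (\<Sum>i\<in>I. c i * e i)"

lemma lin_insert:
  "finite I \<Longrightarrow> k \<notin> I \<Longrightarrow> lin (insert k I) c (e(k := y)) = c k * y + lin I c e"
  unfolding lin_def by (subst sum.insert) (auto intro!: sum.cong)

lemma sign_mean_lin: "finite I \<Longrightarrow> sign_mean I (lin I c) = 0"
proof (induction I rule: finite_induct)
  case (insert k I)
  thus ?case by (simp add: sign_mean_insert lin_insert)
qed (simp add: lin_def sign_mean_def)

lemma sign_mean_lin_sq: "finite I \<Longrightarrow> sign_mean I (\<lambda>e. (lin I c e)\<^sup>2) = (\<Sum>i\<in>I. (c i)\<^sup>2)"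
proof (induction I rule: finite_induct)
  case (insert k I)
  have "sign_mean (insert k I) (\<lambda>e. (lin (insert k I) c e)\<^sup>2)
      = sign_mean I (\<lambda>e. (c k)\<^sup>2 + (lin I c e)\<^sup>2)"
    using insert.hyps
    by (simp add: sign_mean_insert lin_insert power2_eq_square algebra_simps add_divide_distrib)
  thus ?case using insert by (simp add: sign_mean_add sign_mean_const)
qed (simp add: lin_def sign_mean_def)

text \<open>Averaging (L + 1)^4 and (L - 1)^4 leaves 1 + 6 L^2 + L^4. As L^2 has mean n, the fourth
  moment grows by 6n + 1 when a sign is added to n others.\<close>

lemma sign_mean_sum_pow4:
  "finite I \<Longrightarrow> sign_mean I (\<lambda>e. (lin I (\<lambda>_. 1) e) ^ 4) = 3 * real (card I) ^ 2 - 2 * real (card I)"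
proof (induction I rule: finite_induct)
  case (insert k I)
  have "sign_mean (insert k I) (\<lambda>e. (lin (insert k I) (\<lambda>_. 1) e) ^ 4)
      = sign_mean I (\<lambda>e. 1 + (6 * (lin I (\<lambda>_. 1) e)\<^sup>2 + (lin I (\<lambda>_. 1) e) ^ 4))"
    using insert.hyps
    by (simp add: sign_mean_insert lin_insert power2_eq_square power4_eq_xxxx algebra_simps add_divide_distrib)
  thus ?case using insert 
    by (simp only: sign_mean_add sign_mean_cmult sign_mean_const sign_mean_lin_sq)
       (simp add: power2_eq_square algebra_simps)
qed (simp add: lin_def sign_mean_def signs_def)

lemma sign_mean_sum_sq_variance:
  assumes "finite I"
  shows "sign_mean I (\<lambda>e. ((lin I (\<lambda>_. 1) e)\<^sup>2 - card I)\<^sup>2) = 2 * real (card I) ^ 2 - 2 * real (card I)"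
proof -
  have "sign_mean I (\<lambda>e. ((lin I (\<lambda>_. 1) e)\<^sup>2 - card I)\<^sup>2)
    = sign_mean I (\<lambda>e. (lin I (\<lambda>_. 1) e) ^ 4 + ((-2 * card I) * (lin I (\<lambda>_. 1) e)\<^sup>2 + (card I)\<^sup>2))"
    by (intro sign_mean_cong) (simp add: power2_eq_square power4_eq_xxxx algebra_simps)
  also have "\<dots> = 2 * real (card I) ^ 2 - 2 * real (card I)"
    using assms
    by (simp only: sign_mean_add sign_mean_cmult sign_mean_sum_pow4 sign_mean_lin_sq sign_mean_const)
       (simp add: power2_eq_square algebra_simps)
  finally show ?thesis .
qed

lemma sign_mean_chebyshev:
  assumes "finite I" "t > 0" and B: "sign_mean I (\<lambda>e. (f e - c)\<^sup>2) \<le> B"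
  shows "real (card {e \<in> signs I. \<not> \<bar>f e - c\<bar> \<le> t}) \<le> B / t\<^sup>2 * 2 ^ card I"
proof -
  let ?S = "{e \<in> signs I. \<not> \<bar>f e - c\<bar> \<le> t}"
  have "t\<^sup>2 * real (card ?S) = (\<Sum>e\<in>?S. t\<^sup>2)" by simp
  also have "\<dots> \<le> (\<Sum>e\<in>?S. (f e - c)\<^sup>2)"
    using assms(2) by (intro sum_mono) (auto simp: abs_le_square_iff[symmetric])
  also have "\<dots> \<le> (\<Sum>e\<in>signs I. (f e - c)\<^sup>2)"
    using assms(1) by (intro sum_mono2) (auto simp: finite_signs)
  also have "\<dots> \<le> B * 2 ^ card I"
    using B by (simp add: sign_mean_def field_simps)
  finally show ?thesis using assms(2) by (simp add: field_simps)
qed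

section \<open>Mean and variance of the squared distance\<close>

lemma sum_squared_le_card:
  fixes f :: "'i \<Rightarrow> real"
  shows "(\<Sum>i\<in>I. f i)\<^sup>2 \<le> card I * (\<Sum>i\<in>I. (f i)\<^sup>2)"
  using Cauchy_Schwarz_ineq_sum[of "\<lambda>_. 1" f I] by simp

text \<open>This is the squared distance in coordinates divided by \<open>N\<close>:
  \<open>x\<close> belongs to the fixed point, \<open>e\<close> to the vertex, and \<kappa> will be
  (p + 1) / p^2. The denominator comes from the normalization of \<open>cyc_dist\<close>, with p - 1
  as the number of coordinates.\<close>

definition sq_form :: "'i set \<Rightarrow> real \<Rightarrow> ('i \<Rightarrow> real) \<Rightarrow> ('i \<Rightarrow> int) \<Rightarrow> real" where
  "sq_form I \<kappa> x e = ((\<Sum>i\<in>I. (e i - x i)\<^sup>2) - \<kappa> * (\<Sum>i\<in>I. e i - x i)\<^sup>2) / (4 * card I)"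

context
  fixes I :: "'i set" and \<kappa> :: real and x :: "'i \<Rightarrow> real"
  assumes fin: "finite I" and card: "card I \<ge> 2" and \<kappa>: "\<kappa> \<ge> 0" "\<kappa> * card I \<le> 1"
    and x: "\<And>i. i \<in> I \<Longrightarrow> \<bar>x i\<bar> \<le> 1"
begin

text \<open>Cauchy-Schwarz loses a factor \<open>card I\<close>, which the condition on \<kappa>
  absorbs. Both nonnegativity of the form and the lower bound for its mean depend on this.\<close>

lemma scaled_sum_squared_le: "\<kappa> * (\<Sum>i\<in>I. f i)\<^sup>2 \<le> (\<Sum>i\<in>I. (f i)\<^sup>2)"
proof -
  have "\<kappa> * (\<Sum>i\<in>I. f i)\<^sup>2 \<le> \<kappa> * (card I * (\<Sum>i\<in>I. (f i)\<^sup>2))"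
    using \<kappa> by (intro mult_left_mono sum_squared_le_card)
  also have "\<dots> = (\<kappa> * card I) * (\<Sum>i\<in>I. (f i)\<^sup>2)" by simp
  also have "\<dots> \<le> 1 * (\<Sum>i\<in>I. (f i)\<^sup>2)"
    using \<kappa> by (intro mult_right_mono sum_nonneg) auto
  finally show ?thesis by simp
qed

lemma sq_form_nonneg: "sq_form I \<kappa> x e \<ge> 0"
  using scaled_sum_squared_le[of "\<lambda>i. e i - x i"] by (simp add: sq_form_def)

text \<open>Because every sign squares to 1, the form splits into a constant, a linear form and a
  multiple of the centred square of the sign sum. The last two have mean zero, so the constant is
  the scaled mean.\<close>

lemma sq_form_expand:
  assumes "e \<in> signs I"
  shows "4 * card I * sq_form I \<kappa> x e
    = (card I + (\<Sum>i\<in>I. (x i)\<^sup>2) - \<kappa> * (card I + (\<Sum>i\<in>I. x i)\<^sup>2))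
      + (lin I (\<lambda>i. 2 * \<kappa> * (\<Sum>i\<in>I. x i) - 2 * x i) e - \<kappa> * ((lin I (\<lambda>_. 1) e)\<^sup>2 - card I))"
proof -
  have e: "(real_of_int (e i))\<^sup>2 = 1" if "i \<in> I" for i
    using assms that by (auto simp: signs_def PiE_iff)
  have "(\<Sum>i\<in>I. (e i - x i)\<^sup>2) = (\<Sum>i\<in>I. 1 - 2 * (x i * e i) + (x i)\<^sup>2)"
    using e by (intro sum.cong) (auto simp: power2_diff)
  also have "\<dots> = card I - 2 * (\<Sum>i\<in>I. x i * e i) + (\<Sum>i\<in>I. (x i)\<^sup>2)"
    by (simp add: sum.distrib sum_subtractf sum_distrib_left)
  finally have 1: "(\<Sum>i\<in>I. (e i - x i)\<^sup>2) = card I - 2 * (\<Sum>i\<in>I. x i * e i) + (\<Sum>i\<in>I. (x i)\<^sup>2)" .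
  have 2: "lin I (\<lambda>i. 2 * \<kappa> * s - 2 * x i) e = 2 * \<kappa> * s * (\<Sum>i\<in>I. e i) - 2 * (\<Sum>i\<in>I. x i * e i)" for s
    by (simp add: lin_def algebra_simps sum_subtractf sum_distrib_left)
  have 3: "lin I (\<lambda>_. 1) e = (\<Sum>i\<in>I. e i)" by (simp add: lin_def)
  have 4: "(\<Sum>i\<in>I. e i - x i) = (\<Sum>i\<in>I. e i) - (\<Sum>i\<in>I. x i)" by (simp add: sum_subtractf)
  have 5: "4 * card I * sq_form I \<kappa> x e = (\<Sum>i\<in>I. (e i - x i)\<^sup>2) - \<kappa> * (\<Sum>i\<in>I. e i - x i)\<^sup>2"
    using card by (simp add: sq_form_def)
  show ?thesis
    unfolding 5 1 2 3 4 by (simp add: power2_eq_square algebra_simps)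
qed

lemma sign_mean_sq_form:
  "4 * card I * sign_mean I (sq_form I \<kappa> x)
    = card I + (\<Sum>i\<in>I. (x i)\<^sup>2) - \<kappa> * (card I + (\<Sum>i\<in>I. x i)\<^sup>2)" (is "_ = ?m")
proof -
  let ?c = "\<lambda>i. 2 * \<kappa> * (\<Sum>i\<in>I. x i) - 2 * x i"
  have "4 * card I * sign_mean I (sq_form I \<kappa> x) = sign_mean I (\<lambda>e. 4 * card I * sq_form I \<kappa> x e)"
    by (simp add: sign_mean_cmult)
  also have "\<dots> = sign_mean I (\<lambda>e. (?m + \<kappa> * card I) + (lin I ?c e + (- \<kappa>) * (lin I (\<lambda>_. 1) e)\<^sup>2))"
    by (intro sign_mean_cong, subst sq_form_expand) (auto simp: algebra_simps)
  also have "\<dots> = ?m"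
    using fin by (simp only: sign_mean_add sign_mean_cmult sign_mean_const sign_mean_lin sign_mean_lin_sq) simp
  finally show ?thesis .
qed

lemma sign_mean_sq_form_ge: "4 * card I * sign_mean I (sq_form I \<kappa> x) \<ge> real (card I) - 1"
  using scaled_sum_squared_le[of x] \<kappa> unfolding sign_mean_sq_form by (simp add: algebra_simps)

text \<open>Scaled by 4n, the deviation from the mean is a linear form minus \<kappa> times a
  centred square. Their second moments are at most 4n and equal to 2n^2 - 2n; with \<kappa> n at
  most 1 the total is at most 8n + 4, to be divided by 16 n^2.\<close>

lemma sq_form_variance:
  "sign_mean I (\<lambda>e. (sq_form I \<kappa> x e - sign_mean I (sq_form I \<kappa> x))\<^sup>2)
     \<le> (2 * real (card I) + 1) / (4 * (real (card I))\<^sup>2)"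
proof -
  define n where "n = real (card I)"
  define s where "s = (\<Sum>i\<in>I. x i)"
  define c where "c = (\<lambda>i. 2 * \<kappa> * s - 2 * x i)"
  define A where "A = sign_mean I (sq_form I \<kappa> x)"
  let ?L = "lin I c" and ?D = "\<lambda>e. (lin I (\<lambda>_. 1) e)\<^sup>2 - card I"
  have n: "n \<ge> 2" using card by (simp add: n_def)
  have \<kappa>n: "\<kappa> * n \<le> 1" using \<kappa> by (simp add: n_def)
  have le: "(4 * n * (sq_form I \<kappa> x e - A))\<^sup>2 \<le> 2 * (?L e)\<^sup>2 + 2 * \<kappa>\<^sup>2 * (?D e)\<^sup>2"
    if "e \<in> signs I" for e
  proof -
    have "4 * n * (sq_form I \<kappa> x e - A) = ?L e - \<kappa> * ?D e"
      using sq_form_expand[OF that] sign_mean_sq_form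
      by (simp add: n_def A_def c_def s_def right_diff_distrib)
    hence "(4 * n * (sq_form I \<kappa> x e - A))\<^sup>2 = (?L e - \<kappa> * ?D e)\<^sup>2" by simp
    \<comment> \<open>The difference of the two sides is the square of the sum, so mixed moments
      need not be computed.\<close>
    also have "\<dots> \<le> 2 * (?L e)\<^sup>2 + 2 * (\<kappa> * ?D e)\<^sup>2"
      using zero_le_power2[of "?L e + \<kappa> * ?D e"] by (simp add: power2_sum power2_diff)
    finally show ?thesis by (simp add: power_mult_distrib)
  qed
  have Q: "(\<Sum>i\<in>I. (x i)\<^sup>2) \<le> n"
    using sum_bounded_above[of I "\<lambda>i. (x i)\<^sup>2" 1] x by (simp add: n_def abs_square_le_1)
  have "(\<Sum>i\<in>I. (c i)\<^sup>2) = (\<Sum>i\<in>I. 4 * \<kappa>\<^sup>2 * s\<^sup>2 - 8 * \<kappa> * s * x i + 4 * (x i)\<^sup>2)"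
    by (intro sum.cong) (auto simp: c_def power2_eq_square algebra_simps)
  also have "\<dots> = n * (4 * \<kappa>\<^sup>2 * s\<^sup>2) - 8 * \<kappa> * s * s + 4 * (\<Sum>i\<in>I. (x i)\<^sup>2)"
    by (simp add: sum.distrib sum_subtractf n_def flip: sum_distrib_left s_def)
  also have "\<dots> = 4 * (\<kappa> * s\<^sup>2) * (\<kappa> * n) - 8 * (\<kappa> * s\<^sup>2) + 4 * (\<Sum>i\<in>I. (x i)\<^sup>2)"
    by (simp add: power2_eq_square)
  \<comment> \<open>Using \<kappa> n at most 1 makes the combined coefficient of \<kappa> s^2 equal
    to 4 - 8, which is negative.\<close>
  also have "\<dots> \<le> 4 * (\<kappa> * s\<^sup>2) * 1 - 8 * (\<kappa> * s\<^sup>2) + 4 * n"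
    using Q \<kappa> \<kappa>n by (intro add_mono diff_mono mult_left_mono) auto
  also have "\<dots> \<le> 4 * n" using \<kappa> by simp
  finally have c: "(\<Sum>i\<in>I. (c i)\<^sup>2) \<le> 4 * n" .
  have "16 * n\<^sup>2 * sign_mean I (\<lambda>e. (sq_form I \<kappa> x e - A)\<^sup>2)
      = sign_mean I (\<lambda>e. (4 * n * (sq_form I \<kappa> x e - A))\<^sup>2)"
    by (simp add: power_mult_distrib sign_mean_cmult)
  also have "\<dots> \<le> sign_mean I (\<lambda>e. 2 * (?L e)\<^sup>2 + 2 * \<kappa>\<^sup>2 * (?D e)\<^sup>2)"
    by (intro sign_mean_mono le)
  also have "\<dots> = 2 * (\<Sum>i\<in>I. (c i)\<^sup>2) + 2 * \<kappa>\<^sup>2 * (2 * n\<^sup>2 - 2 * n)"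
    using fin by (simp only: sign_mean_add sign_mean_cmult sign_mean_lin_sq sign_mean_sum_sq_variance n_def)
  also have "\<dots> \<le> 2 * (4 * n) + 4 * (\<kappa> * n)\<^sup>2"
    using c n by (intro add_mono mult_left_mono) (simp_all add: power_mult_distrib algebra_simps)
  also have "\<dots> \<le> 2 * (4 * n) + 4 * 1"
    using \<kappa> \<kappa>n n by (intro add_mono mult_left_mono) (auto simp: power_le_one)
  finally show ?thesis
    using n unfolding A_def n_def by (simp add: field_simps)
qed

text \<open>Chebyshev is applied to the second moment \<open>M\<close> of the root about the root of
  the mean \<open>A\<close>. Dividing the variance bound by \<open>A\<close>, which is at least (n -
  1) / (4n), bounds \<open>M\<close> by (2n + 1) / (n (n - 1)). In the application n + 1 is
  \<open>p\<close>, and 22 is half of the constant 44.\<close>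

lemma sqrt_sq_form_concentration:
  assumes "t > 0"
  shows "real (card {e \<in> signs I. \<not> \<bar>sqrt (sq_form I \<kappa> x e) - sqrt (sign_mean I (sq_form I \<kappa> x))\<bar> \<le> t})
    \<le> 22 / (real (card I) + 1) / t\<^sup>2 * 2 ^ card I"
proof (rule sign_mean_chebyshev[OF fin assms])
  define n where "n = real (card I)"
  define A where "A = sign_mean I (sq_form I \<kappa> x)"
  let ?Z = "sq_form I \<kappa> x"
  have n: "n \<ge> 2" using card by (simp add: n_def)
  have A: "4 * n * A \<ge> n - 1"
    using sign_mean_sq_form_ge by (simp add: n_def A_def)
  hence "0 < n * A" using n by linarith
  hence "A > 0" using n by (simp add: zero_less_mult_iff)
  have le: "A * (sqrt (?Z e) - sqrt A)\<^sup>2 \<le> (?Z e - A)\<^sup>2" for e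
  proof -
    have "A = (sqrt A)\<^sup>2" using \<open>A > 0\<close> by simp
    also have "\<dots> \<le> (sqrt (?Z e) + sqrt A)\<^sup>2"
      using \<open>A > 0\<close> sq_form_nonneg by (intro power_mono) auto
    finally have "A * (sqrt (?Z e) - sqrt A)\<^sup>2 \<le> (sqrt (?Z e) + sqrt A)\<^sup>2 * (sqrt (?Z e) - sqrt A)\<^sup>2"
      by (intro mult_right_mono) auto
    also have "\<dots> = ((sqrt (?Z e))\<^sup>2 - (sqrt A)\<^sup>2)\<^sup>2"
      by (simp add: power2_eq_square algebra_simps)
    finally show ?thesis using \<open>A > 0\<close> sq_form_nonneg by simp
  qed
  define M where "M = sign_mean I (\<lambda>e. (sqrt (?Z e) - sqrt A)\<^sup>2)"
  have "M \<ge> 0" by (auto simp: M_def sign_mean_def intro!: divide_nonneg_nonneg sum_nonneg)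
  have "A * M \<le> sign_mean I (\<lambda>e. (?Z e - A)\<^sup>2)"
    unfolding M_def sign_mean_cmult[symmetric] by (intro sign_mean_mono le)
  also have "\<dots> \<le> (2 * n + 1) / (4 * n\<^sup>2)"
    using sq_form_variance by (simp add: n_def A_def)
  finally have *: "A * M \<le> (2 * n + 1) / (4 * n\<^sup>2)" .
  have "(n - 1) * M \<le> 4 * n * A * M"
    using A \<open>M \<ge> 0\<close> by (intro mult_right_mono)
  also have "\<dots> = 4 * n * (A * M)" by simp
  also have "\<dots> \<le> 4 * n * ((2 * n + 1) / (4 * n\<^sup>2))"
    using n by (intro mult_left_mono[OF *]) simp
  also have "\<dots> = (2 * n + 1) / n" using n by (simp add: power2_eq_square)
  finally have "M \<le> (2 * n + 1) / n / (n - 1)"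
    using n by (subst pos_le_divide_eq) (simp_all add: mult.commute)
  also have "\<dots> = (2 * n + 1) / (n * (n - 1))" by simp
  also have "\<dots> \<le> 22 / (n + 1)"
  proof (rule frac_le_eq[THEN iffD2])
    show "n * (n - 1) \<noteq> 0" "n + 1 \<noteq> 0" using n by auto
    \<comment> \<open>For n at least 2 this gives 1 + 25n - 20n^2 at most 1 - 15n, which is
      negative.\<close>
    have "n * 2 \<le> n * n" using n by (intro mult_left_mono) auto
    moreover have "(2 * n + 1) * (n + 1) - 22 * (n * (n - 1)) = 1 + 25 * n - 20 * (n * n)"
      by (simp add: algebra_simps)
    ultimately have "(2 * n + 1) * (n + 1) - 22 * (n * (n - 1)) \<le> 0" using n by linarith
    thus "((2 * n + 1) * (n + 1) - 22 * (n * (n - 1))) / (n * (n - 1) * (n + 1)) \<le> 0"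
      using n by (intro divide_nonpos_pos mult_pos_pos) simp_all
  qed
  finally show "sign_mean I (\<lambda>e. (sqrt (?Z e) - sqrt (sign_mean I ?Z))\<^sup>2) \<le> 22 / (real (card I) + 1)"
    by (simp add: M_def A_def n_def)
qed

end

section \<open>Concentration of distances\<close>

definition vertex :: "nat \<Rightarrow> nat \<Rightarrow> (nat \<Rightarrow> int) \<Rightarrow> complex" where
  "vertex p N e = (\<Sum>j=1..p-1. of_int (int N * e j) * zeta p ^ j)"

lemma cyc_vertices_eq_image: "cyc_vertices p N = vertex p N ` signs {1..p-1}"
proof (intro equalityI subsetI)
  fix x assume "x \<in> cyc_vertices p N"
  then obtain a :: "nat \<Rightarrow> int" where x: "x = (\<Sum>j=1..p-1. of_int (a j) * zeta p ^ j)"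
    and a: "\<And>j. j \<in> {1..p-1} \<Longrightarrow> a j \<in> {- int N, int N}"
    unfolding cyc_vertices_def by blast
  \<comment> \<open>For \<open>N = 0\<close> both corner values coincide and the sign + 1 is chosen,
    which still reproduces the coordinate.\<close>
  define e where "e = restrict (\<lambda>j. if a j = int N then 1 else - 1 :: int) {1..p-1}"
  have "e \<in> signs {1..p-1}" by (auto simp: e_def signs_def)
  moreover have "a j = int N * e j" if "j \<in> {1..p-1}" for j
    using a[OF that] that by (auto simp: e_def)
  hence "x = vertex p N e"
    unfolding x vertex_def by (intro sum.cong) auto
  ultimately show "x \<in> vertex p N ` signs {1..p-1}" by blast
next
  fix x assume "x \<in> vertex p N ` signs {1..p-1}"
  then obtain e where e: "e \<in> signs {1..p-1}" "x = vertex p N e" by blast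
  have "\<forall>j\<in>{1..p-1}. int N * e j \<in> {- int N, int N}"
    using e(1) by (auto simp: signs_def PiE_iff)
  thus "x \<in> cyc_vertices p N"
    unfolding cyc_vertices_def e(2) vertex_def
    by (intro CollectI exI[of _ "\<lambda>j. int N * e j"] conjI refl)
qed

lemma inj_on_vertex:
  assumes "Factorial_Ring.prime p" "N \<ge> 1"
  shows "inj_on (vertex p N) (signs {1..p-1})"
proof (rule inj_onI)
  fix e f assume e: "e \<in> signs {1..p-1}" and f: "f \<in> signs {1..p-1}" and eq: "vertex p N e = vertex p N f"
  have "(\<Sum>j=1..p-1. of_int (int N * e j - int N * f j) * zeta p ^ j) = vertex p N e - vertex p N f"
    unfolding vertex_def sum_subtractf[symmetric] by (intro sum.cong) (auto simp: algebra_simps)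
  hence 0: "(\<Sum>j=1..p-1. of_int (int N * e j - int N * f j) * zeta p ^ j) = 0" using eq by simp
  show "e = f"
  proof (rule PiE_ext[OF e[unfolded signs_def] f[unfolded signs_def]])
    fix j assume "j \<in> {1..p-1}"
    thus "e j = f j" using coords_eq_0[OF assms(1) 0, of j] assms(2) by simp
  qed
qed

text \<open>Dividing the coordinates by \<open>N\<close> takes N^2 out of the squared norm; taking
  out p^2 as well cancels the normalization and leaves (p + 1) / p^2 as the coefficient of the
  squared coordinate sum.\<close>

lemma cyc_dist_vertex:
  fixes a :: "nat \<Rightarrow> int"
  assumes p: "Factorial_Ring.prime p" and N: "N \<ge> 1"
  shows "cyc_dist p N (\<Sum>j=1..p-1. of_int (a j) * zeta p ^ j) (vertex p N e)
    = sqrt (sq_form {1..p-1} ((real p + 1) / (real p)\<^sup>2) (\<lambda>j. of_int (a j) / real N) e)"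
proof -
  let ?I = "{1..p-1}"
  define Q where "Q = (\<Sum>i\<in>?I. (of_int (e i) - of_int (a i) / real N)\<^sup>2)"
  define s where "s = (\<Sum>i\<in>?I. of_int (e i) - of_int (a i) / real N)"
  have p1: "p > 1" using prime_gt_1_nat[OF p] .
  have "vertex p N e - (\<Sum>j=1..p-1. of_int (a j) * zeta p ^ j)
      = (\<Sum>j=1..p-1. of_int (int N * e j - a j) * zeta p ^ j)"
    unfolding vertex_def sum_subtractf[symmetric] by (intro sum.cong) (auto simp: algebra_simps)
  moreover have "(\<Sum>i\<in>?I. (of_int (int N * e i - a i))\<^sup>2) = (real N)\<^sup>2 * Q"
    using N unfolding Q_def sum_distrib_left
    by (intro sum.cong) (auto simp: power2_eq_square field_simps)
  moreover have "(\<Sum>i\<in>?I. of_int (int N * e i - a i)) = real N * s"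
    using N unfolding s_def sum_distrib_left
    by (intro sum.cong) (auto simp: field_simps)
  ultimately have "cyc_norm p (vertex p N e - (\<Sum>j=1..p-1. of_int (a j) * zeta p ^ j))
      = sqrt ((real p)\<^sup>2 * ((real N)\<^sup>2 * Q) - (real p + 1) * (real N * s)\<^sup>2)"
    by (simp only: cyc_norm_coords[OF p])
  moreover have "2 * real N * real p * sqrt (real p - 1) = sqrt (4 * (real N)\<^sup>2 * (real p)\<^sup>2 * (real p - 1))"
    by (simp add: real_sqrt_mult)
  ultimately have "cyc_dist p N (\<Sum>j=1..p-1. of_int (a j) * zeta p ^ j) (vertex p N e)
     = sqrt (((real p)\<^sup>2 * ((real N)\<^sup>2 * Q) - (real p + 1) * (real N * s)\<^sup>2)
          / (4 * (real N)\<^sup>2 * (real p)\<^sup>2 * (real p - 1)))"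
    unfolding cyc_dist_def by (simp only: real_sqrt_divide)
  also have "((real p)\<^sup>2 * ((real N)\<^sup>2 * Q) - (real p + 1) * (real N * s)\<^sup>2)
          / (4 * (real N)\<^sup>2 * (real p)\<^sup>2 * (real p - 1))
      = (Q - (real p + 1) / (real p)\<^sup>2 * s\<^sup>2) / (4 * (real p - 1))"
  proof -
    have "(real p)\<^sup>2 * ((real N)\<^sup>2 * Q) - (real p + 1) * (real N * s)\<^sup>2
        = ((real N)\<^sup>2 * (real p)\<^sup>2) * (Q - (real p + 1) / (real p)\<^sup>2 * s\<^sup>2)"
      using p1 by (simp add: right_diff_distrib power_mult_distrib)
    moreover have "4 * (real N)\<^sup>2 * (real p)\<^sup>2 * (real p - 1) = ((real N)\<^sup>2 * (real p)\<^sup>2) * (4 * (real p - 1))"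
      by simp
    ultimately show ?thesis using p1 N by (simp only: mult_divide_mult_cancel_left) simp
  qed
  also have "\<dots> = sq_form ?I ((real p + 1) / (real p)\<^sup>2) (\<lambda>j. of_int (a j) / real N) e"
    using p1 by (simp add: sq_form_def Q_def s_def of_nat_diff)
  finally show ?thesis .
qed

theorem theorem6:
  fixes \<eta> :: real and N p :: nat and \<alpha> :: complex
  assumes "0 < \<eta>" and "\<eta> < 1 / 2"
    and "N \<ge> 1"
    and "Factorial_Ring.prime p" and "odd p"
    and "\<alpha> \<in> cyc_box p N"
  shows
    "let V = cyc_vertices p N;
         A = mean_sq_dist p N \<alpha> V;
         I = {sqrt A - real p powr (- \<eta>)..sqrt A + real p powr (- \<eta>)}
     in 1 / (real (card V))\<^sup>2 *
          real (card {(\<beta>1, \<beta>2) \<in> V \<times> V. cyc_dist p N \<alpha> \<beta>1 \<in> I \<and> cyc_dist p N \<alpha> \<beta>2 \<in> I})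
        \<ge> 1 - 44 / real p powr (1 - 2 * \<eta>)"
proof -
  note p = assms(4)
  define J where "J = {1..p-1}"
  define V where "V = cyc_vertices p N"
  define A where "A = mean_sq_dist p N \<alpha> V"
  define t where "t = real p powr (- \<eta>)"
  define I where "I = {sqrt A - t..sqrt A + t}"
  define \<kappa> where "\<kappa> = (real p + 1) / (real p)\<^sup>2"
  define \<delta> where "\<delta> = 22 / real p powr (1 - 2 * \<eta>)"
  obtain a :: "nat \<Rightarrow> int" where \<alpha>: "\<alpha> = (\<Sum>j=1..p-1. of_int (a j) * zeta p ^ j)"
    and a: "\<forall>j\<in>{1..p-1}. a j \<in> {- int N..int N}"
    using assms(6) unfolding cyc_box_def by blast
  define x where "x = (\<lambda>j. real_of_int (a j) / real N)"
  let ?Z = "sq_form J \<kappa> x" and ?D = "cyc_dist p N \<alpha>"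
  have p1: "p > 1" using prime_gt_1_nat[OF p] .
  have p3: "p \<ge> 3" using p1 assms(5) by (cases "p = 2") auto
  have fin: "finite J" and card: "card J \<ge> 2" and cardJ: "real (card J) = real p - 1"
    using p3 by (simp_all add: J_def of_nat_diff)
  \<comment> \<open>The product is (p + 1)(p - 1) / p^2 = 1 - 1 / p^2.\<close>
  have \<kappa>: "\<kappa> \<ge> 0" "\<kappa> * card J \<le> 1"
    using p1 unfolding cardJ by (simp_all add: \<kappa>_def divide_simps) (simp add: power2_eq_square algebra_simps)
  have x: "\<bar>x i\<bar> \<le> 1" if "i \<in> J" for i
  proof -
    have "a i \<in> {- int N..int N}" using a that unfolding J_def by blast
    hence "\<bar>a i\<bar> \<le> int N" by auto
    hence "\<bar>real_of_int (a i)\<bar> \<le> real N" by linarith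
    thus ?thesis using assms(3) by (simp add: x_def)
  qed
  have D: "?D (vertex p N e) = sqrt (?Z e)" for e
    unfolding \<alpha> cyc_dist_vertex[OF p assms(3)] by (simp add: J_def \<kappa>_def x_def)
  have V: "V = vertex p N ` signs J" and inj: "inj_on (vertex p N) (signs J)"
    using inj_on_vertex[OF p assms(3)] by (simp_all add: V_def J_def cyc_vertices_eq_image)
  have finV: "finite V" and cardV: "card V = 2 ^ card J"
    using fin by (simp_all add: V finite_signs card_signs card_image[OF inj])
  \<comment> \<open>Injectivity of the parametrization turns the average over vertices into an
    average over signs; nonnegativity of the form removes the squared root.\<close>
  have "A = sign_mean J ?Z"
    using sq_form_nonneg[OF fin card \<kappa> x]
    unfolding A_def mean_sq_dist_def cardV unfolding V sum.reindex[OF inj]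
    by (simp add: D sign_mean_def)
  hence conc: "real (card {e \<in> signs J. \<not> \<bar>sqrt (?Z e) - sqrt A\<bar> \<le> t}) \<le> 22 / real p / t\<^sup>2 * 2 ^ card J"
    using sqrt_sq_form_concentration[OF fin card \<kappa> x, where t = t] p1 by (simp add: t_def cardJ)
  \<comment> \<open>Here t^2 is \<open>p\<close> to the power - 2\<eta>.\<close>
  have "22 / real p / t\<^sup>2 = \<delta>"
    using p1 unfolding t_def \<delta>_def
    by (simp add: powr_diff powr_minus powr_realpow[symmetric] powr_powr field_simps)
  define G where "G = {\<beta> \<in> V. ?D \<beta> \<in> I}"
  have "V - G = {\<beta> \<in> V. ?D \<beta> \<notin> I}" by (auto simp: G_def)
  hence "V - G = vertex p N ` {e \<in> signs J. ?D (vertex p N e) \<notin> I}"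
    unfolding V Compr_image_eq .
  moreover have "?D (vertex p N e) \<notin> I \<longleftrightarrow> \<not> \<bar>sqrt (?Z e) - sqrt A\<bar> \<le> t" for e
    unfolding D by (auto simp: I_def abs_le_iff)
  ultimately have "V - G = vertex p N ` {e \<in> signs J. \<not> \<bar>sqrt (?Z e) - sqrt A\<bar> \<le> t}"
    by simp
  hence "card (V - G) = card {e \<in> signs J. \<not> \<bar>sqrt (?Z e) - sqrt A\<bar> \<le> t}"
    using inj by (simp add: card_image inj_on_subset)
  hence "real (card (V - G)) \<le> \<delta> * card V"
    using conc unfolding \<open>22 / real p / t\<^sup>2 = \<delta>\<close> by (simp add: cardV)
  moreover have "card V = card G + card (V - G)"
    using finV by (subst card_Un_disjoint[symmetric]) (auto simp: G_def intro!: arg_cong[of _ _ card])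
  ultimately have "(1 - \<delta>) * card V \<le> card G" by (simp add: algebra_simps)
  hence r: "1 - \<delta> \<le> card G / card V" by (simp add: cardV pos_le_divide_eq)
  \<comment> \<open>For r the proportion of good vertices, r^2 is at least 2r - 1, which needs no
    sign condition on 1 - \<delta>. The good pairs form \<open>G \<times> G\<close>, so their
    proportion is r^2.\<close>
  have "1 - 2 * \<delta> \<le> (card G / card V)\<^sup>2"
    using r zero_le_power2[of "card G / card V - 1"] by (simp add: power2_diff)
  moreover have "{(\<beta>1, \<beta>2) \<in> V \<times> V. ?D \<beta>1 \<in> I \<and> ?D \<beta>2 \<in> I} = G \<times> G"
    by (auto simp: G_def)
  ultimately have "1 - 44 / real p powr (1 - 2 * \<eta>)
      \<le> 1 / (real (card V))\<^sup>2 * card {(\<beta>1, \<beta>2) \<in> V \<times> V. ?D \<beta>1 \<in> I \<and> ?D \<beta>2 \<in> I}"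
    by (simp add: card_cartesian_product \<delta>_def power2_eq_square)
  thus ?thesis by (simp only: Let_def flip: V_def A_def t_def I_def)
qed

end
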